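(* For every stable allocation instance with rational data and every given feasible rational allocation $x$, there is a finite sequence of best response steps starting from $x$ that leads to a stable allocation.
   Context: A stable allocation instance consists of a bipartite graph $G=(V,E)$ with color classes $J$ (jobs, the active side) and $M$ (machines, the passive side), quotas $q:V\to\mathbb{R}_{\ge 0}$, edge capacities $c:E\to\mathbb{R}_{\ge 0}$, and for every vertex $v$ a strict ranking $\mathrm{rank}_v$ of its incident edges ($uv$ dominates $wv$ at $v$ if $\mathrm{rank}_v(uv)<\mathrm{rank}_v(wv)$). An allocation is $x:E\to\mathbb{R}_{\ge0}$ with $x(e)\le c(e)$ and $x(v):=\sum_{e\in\delta(v)}x(e)\le q(v)$. Write $\bar x(e)=c(e)-x(e)$, $\bar x(v)=q(v)-x(v)$. An edge $jm$ blocks $x$ if (1) $x(jm)<c(jm)$; (2) $x(j)<q(j)$ or $j$ prefers $jm$ to its worst edge with positive value in $x$; (3) $x(m)<q(m)$ or $m$ prefers $jm$ to its worst edge with positive value in $x$. An allocation is stable if no edge blocks it. A best response step of a job $j$ having blocking edges: let $jm$ be the blocking edge of $j$ ranked highest by $j$; $x(jm)$ is increased by $A:=\min\{\bar x(j)+x(\text{edges dominated by }jm\text{ at }j),\ \bar x(jm),\ \bar x(m)+x(\text{edges dominated by }jm\text{ at }m)\}$, after which $j$ and $m$ each first use their free quota and then reduce allocation on their worst allocated edges until the allocation is feasible again. *)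

theory Defs
  imports Complex_Main
begin

text \<open>An edge is a pair (job, machine), so the graph is simple. \<open>incident E v\<close> is the edge set \<open>\<delta>(v)\<close>.\<close>

definition incident :: "('v \<times> 'v) set \<Rightarrow> 'v \<Rightarrow> ('v \<times> 'v) set" where
  "incident E v = {e \<in> E. fst e = v \<or> snd e = v}"

locale stable_allocation_instance =
  fixes J M :: "'v set"
    and E :: "('v \<times> 'v) set"
    and q :: "'v \<Rightarrow> real"
    and c :: "'v \<times> 'v \<Rightarrow> real"
    and rank :: "'v \<Rightarrow> 'v \<times> 'v \<Rightarrow> nat"
  assumes finite_jobs: "finite J"
    and finite_machines: "finite M"
    and disjoint: "J \<inter> M = {}"
    and edges: "E \<subseteq> J \<times> M"
    and quota_nonneg: "v \<in> J \<union> M \<Longrightarrow> 0 \<le> q v"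
    and capacity_nonneg: "e \<in> E \<Longrightarrow> 0 \<le> c e"
    and strict_rank: "v \<in> J \<union> M \<Longrightarrow> inj_on (rank v) (incident E v)"
begin

abbreviation \<delta> :: "'v \<Rightarrow> ('v \<times> 'v) set" where
  "\<delta> v \<equiv> incident E v"

text \<open>Rank 0 is the most preferred.\<close>

definition dominates :: "'v \<Rightarrow> 'v \<times> 'v \<Rightarrow> 'v \<times> 'v \<Rightarrow> bool" where
  "dominates v e f \<longleftrightarrow> e \<in> \<delta> v \<and> f \<in> \<delta> v \<and> rank v e < rank v f"

definition load :: "('v \<times> 'v \<Rightarrow> real) \<Rightarrow> 'v \<Rightarrow> real" where
  "load x v = (\<Sum>e\<in>\<delta> v. x e)"

definition dominated_load :: "('v \<times> 'v \<Rightarrow> real) \<Rightarrow> 'v \<Rightarrow> 'v \<times> 'v \<Rightarrow> real" where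
  "dominated_load x v e = (\<Sum>f\<in>{f \<in> \<delta> v. dominates v e f}. x f)"

text \<open>Values of \<open>x\<close> outside \<open>E\<close> are irrelevant throughout.\<close>

definition allocation :: "('v \<times> 'v \<Rightarrow> real) \<Rightarrow> bool" where
  "allocation x \<longleftrightarrow> (\<forall>e\<in>E. 0 \<le> x e \<and> x e \<le> c e) \<and> (\<forall>v\<in>J \<union> M. load x v \<le> q v)"

definition worst_allocated :: "('v \<times> 'v \<Rightarrow> real) \<Rightarrow> 'v \<Rightarrow> 'v \<times> 'v \<Rightarrow> bool" where
  "worst_allocated x v w \<longleftrightarrow>
     w \<in> \<delta> v \<and> 0 < x w \<and> (\<forall>f\<in>\<delta> v. 0 < x f \<longrightarrow> f = w \<or> dominates v f w)"

definition prefers_to_worst :: "('v \<times> 'v \<Rightarrow> real) \<Rightarrow> 'v \<Rightarrow> 'v \<times> 'v \<Rightarrow> bool" where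
  "prefers_to_worst x v e \<longleftrightarrow> (\<exists>w. worst_allocated x v w \<and> dominates v e w)"

definition blocks :: "('v \<times> 'v \<Rightarrow> real) \<Rightarrow> 'v \<Rightarrow> 'v \<Rightarrow> bool" where
  "blocks x j m \<longleftrightarrow>
     (j, m) \<in> E \<and>
     x (j, m) < c (j, m) \<and>
     (load x j < q j \<or> prefers_to_worst x j (j, m)) \<and>
     (load x m < q m \<or> prefers_to_worst x m (j, m))"

definition stable :: "('v \<times> 'v \<Rightarrow> real) \<Rightarrow> bool" where
  "stable x \<longleftrightarrow> allocation x \<and> \<not> (\<exists>j m. blocks x j m)"

definition best_blocking :: "('v \<times> 'v \<Rightarrow> real) \<Rightarrow> 'v \<Rightarrow> 'v \<Rightarrow> bool" where
  "best_blocking x j m \<longleftrightarrow>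
     blocks x j m \<and> (\<forall>m'. blocks x j m' \<longrightarrow> m' = m \<or> dominates j (j, m) (j, m'))"

definition response_amount :: "('v \<times> 'v \<Rightarrow> real) \<Rightarrow> 'v \<Rightarrow> 'v \<Rightarrow> real" where
  "response_amount x j m =
     Min {q j - load x j + dominated_load x j (j, m),
          c (j, m) - x (j, m),
          q m - load x m + dominated_load x m (j, m)}"

text \<open>\<open>trim v y\<close>: vertex \<open>v\<close>, if its quota is exceeded, reduces its allocation on its worst
  allocated edges until the quota is met. An edge \<open>e\<close> loses the part of the excess that remains
  after all edges worse than \<open>e\<close> have been emptied, but at most \<open>y e\<close>. The lemmas below confirm
  that this closed form is the worst-first reduction.\<close>

definition trim :: "'v \<Rightarrow> ('v \<times> 'v \<Rightarrow> real) \<Rightarrow> 'v \<times> 'v \<Rightarrow> real" where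
  "trim v y e =
     (if e \<in> \<delta> v
      then y e - min (y e) (max 0 (load y v - q v - dominated_load y v e))
      else y e)"

text \<open>The job and the machine can trim one after the other: their only common edge is \<open>(j, m)\<close>,
  and it is never reduced, because the response amount is bounded by the free quota plus the
  dominated load at both ends. Free quota is used first since \<^const>\<open>trim\<close> removes
  only the excess over the quota.\<close>

definition respond :: "('v \<times> 'v \<Rightarrow> real) \<Rightarrow> 'v \<Rightarrow> 'v \<Rightarrow> 'v \<times> 'v \<Rightarrow> real" where
  "respond x j m = trim m (trim j (x((j, m) := x (j, m) + response_amount x j m)))"

definition best_response_step :: "('v \<times> 'v \<Rightarrow> real) \<Rightarrow> ('v \<times> 'v \<Rightarrow> real) \<Rightarrow> bool" where
  "best_response_step x x' \<longleftrightarrow> (\<exists>j\<in>J. \<exists>m\<in>M. best_blocking x j m \<and> x' = respond x j m)"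

lemma finite_incident: "finite (\<delta> v)"
proof -
  have "finite E"
    using edges finite_jobs finite_machines by (meson finite_SigmaI finite_subset)
  then show ?thesis by (simp add: incident_def)
qed

lemma trim_bounds:
  assumes "0 \<le> y e"
  shows "0 \<le> trim v y e" and "trim v y e \<le> y e"
  using assms by (auto simp: trim_def)

lemma trim_worst_first:
  assumes nn: "\<And>f. f \<in> \<delta> v \<Longrightarrow> 0 \<le> y f"
    and e: "trim v y e < y e" and dom: "dominates v e f"
  shows "trim v y f = 0"
proof -
  let ?D = "\<lambda>e. {f \<in> \<delta> v. dominates v e f}"
  have ed: "e \<in> \<delta> v" "f \<in> \<delta> v" using dom by (auto simp: dominates_def)
  have fin: "finite (?D e)" "finite (?D f)" using finite_incident by auto
  have sub: "insert f (?D f) \<subseteq> ?D e" and nf: "f \<notin> ?D f"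
    using dom by (auto simp: dominates_def)
  have "y f + dominated_load y v f = sum y (insert f (?D f))"
    using fin nf by (simp add: dominated_load_def)
  also have "\<dots> \<le> dominated_load y v e"
    unfolding dominated_load_def by (rule sum_mono2[OF fin(1) sub]) (use nn in auto)
  finally have le: "y f + dominated_load y v f \<le> dominated_load y v e" .
  have "dominated_load y v e < load y v - q v"
    using e ed(1) nn[OF ed(1)] by (auto simp: trim_def min_def max_def split: if_splits)
  then show ?thesis using le ed nn[OF ed(2)] by (auto simp: trim_def)
qed

lemma greedy_removal_sum:
  fixes r :: "'e \<Rightarrow> nat" and y :: "'e \<Rightarrow> real"
  assumes "finite D" "inj_on r D" "\<And>e. e \<in> D \<Longrightarrow> 0 \<le> y e" "0 \<le> k"
  shows "(\<Sum>e\<in>D. min (y e) (max 0 (k - sum y {f \<in> D. r e < r f}))) = min k (sum y D)"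
  using assms
proof (induction "card D" arbitrary: D)
  case 0
  then show ?case by simp
next
  case (Suc n)
  then have ne: "D \<noteq> {}" by auto
  define b where "b = arg_min_on r D"
  have b: "b \<in> D" "\<And>e. e \<in> D \<Longrightarrow> r b \<le> r e"
    unfolding b_def using arg_min_if_finite[OF \<open>finite D\<close> ne, of r] by (auto simp: not_less)
  let ?D = "D - {b}"
  have lt: "r b < r e" if "e \<in> ?D" for e
    using that b Suc.prems(2) by (metis DiffE inj_on_eq_iff insertI1 order_le_less)
  have Sb: "{f \<in> D. r b < r f} = ?D" using lt by auto
  have Se: "{f \<in> D. r e < r f} = {f \<in> ?D. r e < r f}" if "e \<in> ?D" for e
    using lt[OF that] by auto
  have IH: "(\<Sum>e\<in>?D. min (y e) (max 0 (k - sum y {f \<in> ?D. r e < r f}))) = min k (sum y ?D)"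
    using Suc.prems Suc.hyps(2) b(1) by (intro Suc.hyps(1)) (auto simp: inj_on_diff)
  have s: "sum y D = y b + sum y ?D" using Suc.prems(1) b(1) by (simp add: sum.remove)
  have p: "0 \<le> sum y ?D" using Suc.prems(3) by (intro sum_nonneg) auto
  have "(\<Sum>e\<in>D. min (y e) (max 0 (k - sum y {f \<in> D. r e < r f}))) =
      min (y b) (max 0 (k - sum y ?D)) +
      (\<Sum>e\<in>?D. min (y e) (max 0 (k - sum y {f \<in> D. r e < r f})))"
    by (subst sum.remove[OF Suc.prems(1) b(1)]) (simp only: Sb)
  also have "(\<Sum>e\<in>?D. min (y e) (max 0 (k - sum y {f \<in> D. r e < r f}))) =
      (\<Sum>e\<in>?D. min (y e) (max 0 (k - sum y {f \<in> ?D. r e < r f})))"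
    by (rule sum.cong) (simp_all only: Se)
  finally show ?case
    using IH s p Suc.prems(3)[OF b(1)] Suc.prems(4) by (auto simp: min_def max_def)
qed

lemma load_trim:
  assumes v: "v \<in> J \<union> M" and nn: "\<And>e. e \<in> \<delta> v \<Longrightarrow> 0 \<le> y e"
  shows "load (trim v y) v = min (load y v) (q v)"
proof -
  let ?k = "max 0 (load y v - q v)"
  have p: "0 \<le> load y v" "0 \<le> q v" "\<And>e. 0 \<le> dominated_load y v e"
    using nn quota_nonneg[OF v] by (auto simp: load_def dominated_load_def intro!: sum_nonneg)
  have deq: "dominated_load y v e = sum y {f \<in> \<delta> v. rank v e < rank v f}" if "e \<in> \<delta> v" for e
    using that unfolding dominated_load_def dominates_def by (intro sum.cong) auto
  have "load (trim v y) v =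
      (\<Sum>e\<in>\<delta> v. y e - min (y e) (max 0 (?k - sum y {f \<in> \<delta> v. rank v e < rank v f})))"
    unfolding load_def[of "trim v y"]
  proof (intro sum.cong refl)
    fix e assume e: "e \<in> \<delta> v"
    then have "max 0 (load y v - q v - dominated_load y v e) =
        max 0 (?k - sum y {f \<in> \<delta> v. rank v e < rank v f})"
      using p(3)[of e] deq[OF e] by (simp add: max_def)
    then show "trim v y e = y e - min (y e) (max 0 (?k - sum y {f \<in> \<delta> v. rank v e < rank v f}))"
      using e by (simp add: trim_def)
  qed
  also have "\<dots> = load y v - min ?k (load y v)"
    using greedy_removal_sum[OF finite_incident strict_rank[OF v] nn, where k = ?k]
    by (simp add: sum_subtractf load_def)
  finally show ?thesis using p by (auto simp: min_def max_def)
qed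

end

end

theory Submission
  imports Defs
begin

text \<open>The sequence has two phases. Call a response reallocating if the job exceeds its free quota
  and hence gives up some of its worst allocation. As long as some job can, by its own responses
  alone, be brought to reallocate, it performs these responses: allocation is lost on one of its
  edges and gained only on better ones, while all other jobs only lose. If an edge weighs a large
  base to the power of its rank at the job, so that worse edges weigh more, the total weight
  drops. Once no job can be brought to reallocate, every response uses free quota only. This
  preserves the property, and it moves the machine's allocation to better edges, so a total
  weight in which better edges of the machine weigh more increases. Rational data lie in
  \<open>(1/N)\<int>\<close> for some \<open>N\<close>, so both potentials bound the number of steps.\<close>

context stable_allocation_instance
begin

section \<open>Room, slack and blocking edges\<close>

definition room :: "('v \<times> 'v \<Rightarrow> real) \<Rightarrow> 'v \<Rightarrow> 'v \<times> 'v \<Rightarrow> real" where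
  "room x v e = q v - load x v + dominated_load x v e"

text \<open>The part of the response amount that does not involve the job: what the edge and its
  machine \<open>snd e\<close> still admit. Keeping it apart from the room at the job makes it
  possible to add it up over the edges of one job.\<close>

definition slack :: "('v \<times> 'v \<Rightarrow> real) \<Rightarrow> 'v \<times> 'v \<Rightarrow> real" where
  "slack x e = min (c e - x e) (room x (snd e) e)"

lemma response_amount_eq:
  "response_amount x j m = min (room x j (j, m)) (slack x (j, m))"
  by (simp add: response_amount_def room_def slack_def)

lemma finite_edges: "finite E"
  using edges finite_jobs finite_machines by (meson finite_SigmaI finite_subset)

lemma incident_subset: "\<delta> v \<subseteq> E"
  by (auto simp: incident_def)

lemma edge_incident: "(j, m) \<in> E \<Longrightarrow> (j, m) \<in> \<delta> j" "(j, m) \<in> E \<Longrightarrow> (j, m) \<in> \<delta> m"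
  by (auto simp: incident_def)

lemma edge_endpoints: "(j, m) \<in> E \<Longrightarrow> j \<in> J" "(j, m) \<in> E \<Longrightarrow> m \<in> M"
  using edges by auto

lemma incident_job: "j \<in> J \<Longrightarrow> e \<in> \<delta> j \<longleftrightarrow> e \<in> E \<and> fst e = j"
  using edges disjoint by (cases e) (auto simp: incident_def)

lemma incident_machine: "m \<in> M \<Longrightarrow> e \<in> \<delta> m \<longleftrightarrow> e \<in> E \<and> snd e = m"
  using edges disjoint by (cases e) (auto simp: incident_def)

lemma incident_Int: "(j, m) \<in> E \<Longrightarrow> \<delta> j \<inter> \<delta> m = {(j, m)}"
  using incident_job[of j] incident_machine[of m] edge_endpoints[of j m] by auto

lemma allocation_nonneg: "allocation x \<Longrightarrow> e \<in> E \<Longrightarrow> 0 \<le> x e"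
  and allocation_le_capacity: "allocation x \<Longrightarrow> e \<in> E \<Longrightarrow> x e \<le> c e"
  and allocation_load_le: "allocation x \<Longrightarrow> v \<in> J \<union> M \<Longrightarrow> load x v \<le> q v"
  by (auto simp: allocation_def)

lemma dominated_load_nonneg:
  "\<forall>f\<in>\<delta> v. 0 \<le> x f \<Longrightarrow> 0 \<le> dominated_load x v e"
  by (auto simp: dominated_load_def intro: sum_nonneg)

lemma dominated_load_cong:
  "(\<And>f. f \<in> \<delta> v \<Longrightarrow> x f = y f) \<Longrightarrow> dominated_load x v e = dominated_load y v e"
  by (auto simp: dominated_load_def intro: sum.cong)

lemma load_cong: "(\<And>f. f \<in> \<delta> v \<Longrightarrow> x f = y f) \<Longrightarrow> load x v = load y v"
  by (auto simp: load_def intro: sum.cong)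

lemma room_cong: "(\<And>f. f \<in> \<delta> v \<Longrightarrow> x f = y f) \<Longrightarrow> room x v e = room y v e"
  unfolding room_def by (metis load_cong dominated_load_cong)

text \<open>Subtracting the load and adding back its dominated part leaves only the edges at least
  as good as \<open>e\<close>. This form suits responses, which change no such edge except the
  raised one.\<close>

lemma room_eq:
  assumes e: "e \<in> \<delta> v"
  shows "room x v e = q v - sum x {f \<in> \<delta> v. rank v f \<le> rank v e}"
proof -
  have "load x v = sum x {f \<in> \<delta> v. rank v f \<le> rank v e} + dominated_load x v e"
    unfolding load_def dominated_load_def
    by (subst sum.union_disjoint[symmetric])
      (use e finite_incident in \<open>auto simp: dominates_def intro!: sum.cong\<close>)
  then show ?thesis by (simp add: room_def)
qed

lemma room_nonneg: "allocation x \<Longrightarrow> v \<in> J \<union> M \<Longrightarrow> 0 \<le> room x v e"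
  using dominated_load_nonneg[of v x e] allocation_load_le[of x v] allocation_nonneg[of x]
    incident_subset[of v] by (force simp: room_def)

lemma slack_nonneg: "allocation x \<Longrightarrow> e \<in> E \<Longrightarrow> 0 \<le> slack x e"
  using room_nonneg[of x "snd e" e] edges by (auto simp: slack_def allocation_le_capacity)

lemma dominated_load_pos_iff:
  assumes nn: "\<forall>f\<in>\<delta> v. 0 \<le> x f"
  shows "0 < dominated_load x v e \<longleftrightarrow> (\<exists>f. dominates v e f \<and> 0 < x f)"
proof -
  have "0 < dominated_load x v e \<longleftrightarrow> dominated_load x v e \<noteq> 0"
    using dominated_load_nonneg[OF nn] by (auto simp: less_le)
  also have "\<dots> \<longleftrightarrow> (\<exists>f \<in> {f \<in> \<delta> v. dominates v e f}. x f \<noteq> 0)"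
    unfolding dominated_load_def
    by (subst sum_nonneg_eq_0_iff) (use nn finite_incident in auto)
  also have "\<dots> \<longleftrightarrow> (\<exists>f. dominates v e f \<and> 0 < x f)"
    using nn by (force simp: dominates_def less_le)
  finally show ?thesis .
qed

text \<open>Whenever some edge below \<open>e\<close> is positive, a positive edge of maximal rank
  lies below \<open>e\<close> too, and strictness of the ranking makes it the unique worst
  one.\<close>

lemma prefers_to_worst_iff:
  assumes v: "v \<in> J \<union> M" and nn: "\<forall>f\<in>\<delta> v. 0 \<le> x f"
  shows "prefers_to_worst x v e \<longleftrightarrow> 0 < dominated_load x v e"
proof
  assume "prefers_to_worst x v e"
  then show "0 < dominated_load x v e"
    unfolding dominated_load_pos_iff[OF nn]
    by (auto simp: prefers_to_worst_def worst_allocated_def)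
next
  assume "0 < dominated_load x v e"
  then obtain f where f: "dominates v e f" "0 < x f"
    using dominated_load_pos_iff[OF nn] by auto
  let ?P = "{f \<in> \<delta> v. 0 < x f}"
  have fin: "finite (rank v ` ?P)" and fP: "f \<in> ?P"
    using f finite_incident by (auto simp: dominates_def)
  then obtain w where w: "w \<in> ?P" "rank v w = Max (rank v ` ?P)"
    using Max_in[OF fin] by (metis (no_types, lifting) empty_iff imageE imageI)
  have max: "rank v g \<le> rank v w" if "g \<in> ?P" for g
    unfolding w(2) using fin that by (intro Max_ge) auto
  have "worst_allocated x v w"
    unfolding worst_allocated_def
  proof (intro conjI ballI impI)
    fix g assume g: "g \<in> \<delta> v" "0 < x g"
    then show "g = w \<or> dominates v g w"
      using max[of g] w(1) strict_rank[OF v]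
      by (auto simp: dominates_def inj_on_def order_le_less)
  qed (use w(1) in auto)
  moreover have "dominates v e w" using f max[OF fP] w(1) by (auto simp: dominates_def)
  ultimately show "prefers_to_worst x v e" unfolding prefers_to_worst_def by blast
qed

text \<open>The three blocking conditions are the positivity of the three terms of the minimum. Free
  quota and dominated load are nonnegative, so their sum is positive iff one of them is.\<close>

lemma blocks_iff:
  assumes x: "allocation x"
  shows "blocks x j m \<longleftrightarrow> (j, m) \<in> E \<and> 0 < response_amount x j m"
proof (cases "(j, m) \<in> E")
  case True
  have *: "load x v < q v \<or> prefers_to_worst x v (j, m) \<longleftrightarrow> 0 < room x v (j, m)"
    if v: "v \<in> J \<union> M" for v
  proof -
    have nn: "\<forall>f\<in>\<delta> v. 0 \<le> x f"
      using allocation_nonneg[OF x] incident_subset by blast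
    show ?thesis
      using allocation_load_le[OF x v] dominated_load_nonneg[OF nn, of "(j, m)"]
      unfolding prefers_to_worst_iff[OF v nn] room_def by linarith
  qed
  show ?thesis
    using True edge_endpoints[OF True]
    by (auto simp: blocks_def * response_amount_eq slack_def)
next
  case False
  then show ?thesis by (simp add: blocks_def)
qed

text \<open>A blocking edge of minimal rank is strictly best because ranks at a vertex are distinct.
  The rank bound carries domination of an edge over from the given blocking edge to the best
  one.\<close>

lemma ex_best_blocking:
  assumes b: "blocks x j m"
  obtains m' where "best_blocking x j m'" "rank j (j, m') \<le> rank j (j, m)"
proof -
  let ?P = "\<lambda>k. blocks x j k"
  let ?r = "\<lambda>k. rank j (j, k)"
  define m' where "m' = arg_min ?r ?P"
  have m': "?P m'" "\<And>k. ?P k \<Longrightarrow> ?r m' \<le> ?r k"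
    unfolding m'_def
    by (rule arg_min_natI[where P = ?P, OF b]) (rule arg_min_nat_le[where P = ?P])
  have "k = m' \<or> dominates j (j, m') (j, k)" if "?P k" for k
  proof -
    have E: "(j, k) \<in> E" "(j, m') \<in> E" using that m'(1) by (auto simp: blocks_def)
    then have "inj_on (rank j) (\<delta> j)" using strict_rank edge_endpoints by blast
    then show ?thesis
      using m'(2)[OF that] inj_onD[of "rank j" "\<delta> j" "(j, m')" "(j, k)"] E
      by (auto simp: dominates_def edge_incident order_le_less)
  qed
  then have "best_blocking x j m'" using m'(1) by (auto simp: best_blocking_def)
  then show ?thesis using that m'(2)[OF b] by blast
qed

text \<open>A settled job cannot be brought to give up any allocation by its own responses: even
  filling all its slack above a positive edge \<open>w\<close> stays within its free quota.\<close>

definition settled :: "('v \<times> 'v \<Rightarrow> real) \<Rightarrow> 'v \<Rightarrow> bool" where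
  "settled x j \<longleftrightarrow>
     (\<forall>w\<in>\<delta> j. 0 < x w \<longrightarrow> sum (slack x) {e. dominates j e w} \<le> q j - load x j)"

section \<open>Effect of trimming at one vertex\<close>

lemma trim_eq_of_load_le:
  assumes "\<forall>f\<in>\<delta> v. 0 \<le> y f" "load y v \<le> q v"
  shows "trim v y = y"
proof
  fix e show "trim v y e = y e"
    using assms dominated_load_nonneg[of v y e] by (auto simp: trim_def)
qed

lemma trim_outside: "e \<notin> \<delta> v \<Longrightarrow> trim v y e = y e"
  by (simp add: trim_def)

lemma trim_cong:
  assumes "\<forall>f\<in>\<delta> v. y f = z f" "e \<in> \<delta> v"
  shows "trim v y e = trim v z e"
  using assms load_cong[of v y z] dominated_load_cong[of v y z e] by (simp add: trim_def)

lemma load_upd: "e \<in> \<delta> v \<Longrightarrow> load (x(e := x e + a)) v = load x v + a"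
  unfolding load_def using finite_incident by (subst (1 2) sum.remove[of _ e]) auto

lemma dominated_load_upd: "dominated_load (x(e := x e + a)) v e = dominated_load x v e"
  by (auto simp: dominated_load_def dominates_def intro!: sum.cong)

text \<open>The bound on \<open>a\<close> keeps the excess within the dominated load of
  \<open>e\<close>. An edge \<open>f\<close> not dominated by \<open>e\<close> has all those
  dominated edges below itself, so the excess is used up before \<open>f\<close> is reached.\<close>

lemma trim_upd_undominated:
  assumes nn: "\<forall>f\<in>\<delta> v. 0 \<le> x f" and e: "e \<in> \<delta> v"
    and a: "0 \<le> a" "a \<le> room x v e" and f: "\<not> dominates v e f"
  shows "trim v (x(e := x e + a)) f = (x(e := x e + a)) f"
proof (cases "f \<in> \<delta> v")
  case True
  let ?y = "x(e := x e + a)"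
  have nn': "\<forall>g\<in>\<delta> v. 0 \<le> ?y g" using nn e a by auto
  have "dominated_load ?y v e \<le> dominated_load ?y v f"
    unfolding dominated_load_def
    using True e f nn' finite_incident by (intro sum_mono2) (auto simp: dominates_def)
  then have "load ?y v - q v - dominated_load ?y v f \<le> 0"
    using a unfolding load_upd[OF e] dominated_load_upd room_def by linarith
  then have "max 0 (load ?y v - q v - dominated_load ?y v f) = 0" by simp
  then show ?thesis
    using bspec[OF nn' True] by (simp only: trim_def min_absorb2 if_True simp_thms) simp
qed (simp add: trim_def)

end

section \<open>A single response to a blocking edge\<close>

locale response = stable_allocation_instance J M E q c rank
  for J M :: "'v set" and E q c rank +
  fixes x :: "'v \<times> 'v \<Rightarrow> real" and j m :: 'v
  assumes allocation: "allocation x" and edge: "(j, m) \<in> E"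
    \<comment> \<open>By \<open>blocks_iff\<close>, this says that the edge blocks
      \<open>x\<close>.\<close>
    and amount_pos: "0 < response_amount x j m"
begin

abbreviation "A \<equiv> response_amount x j m"
abbreviation "x' \<equiv> respond x j m"
abbreviation "raised \<equiv> x((j, m) := x (j, m) + A)"

lemmas job = edge_endpoints(1)[OF edge] and machine = edge_endpoints(2)[OF edge]
lemmas at_job = edge_incident(1)[OF edge] and at_machine = edge_incident(2)[OF edge]

lemma amount_le: "A \<le> room x j (j, m)" "A \<le> slack x (j, m)" "A \<le> room x m (j, m)"
  "A \<le> c (j, m) - x (j, m)"
  by (auto simp: response_amount_eq slack_def)

lemma incident_nonneg: "\<forall>f\<in>\<delta> v. 0 \<le> x f"
  using allocation_nonneg[OF allocation] incident_subset by blast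

lemma raised_nonneg: "\<forall>f\<in>\<delta> v. 0 \<le> raised f"
  using incident_nonneg amount_pos at_job by fastforce

lemma trim_job_undominated: "\<not> dominates j (j, m) f \<Longrightarrow> trim j raised f = raised f"
  and trim_machine_undominated: "\<not> dominates m (j, m) f \<Longrightarrow> trim m raised f = raised f"
  using trim_upd_undominated[OF incident_nonneg at_job _ amount_le(1)]
    trim_upd_undominated[OF incident_nonneg at_machine _ amount_le(3)] amount_pos by auto

lemma trim_job_at_machine:
  assumes "g \<in> \<delta> m"
  shows "trim j raised g = raised g"
proof (cases "g \<in> \<delta> j")
  case True
  then have "g = (j, m)" using assms incident_Int[OF edge] by blast
  then show ?thesis by (intro trim_job_undominated) (simp add: dominates_def)
qed (rule trim_outside)

text \<open>The nested trims decouple: the trim at \<open>m\<close> reads only edges of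
  \<open>m\<close>, and on these the trim at \<open>j\<close> does nothing, since the only shared
  edge is the raised one.\<close>

lemma respond_eq: "x' f = (if f \<in> \<delta> m then trim m raised f else trim j raised f)"
  unfolding respond_def using trim_cong trim_job_at_machine trim_outside by auto

lemma respond_at_job:
  assumes "f \<in> \<delta> j"
  shows "x' f = trim j raised f"
proof (cases "f \<in> \<delta> m")
  case True
  then have "f = (j, m)" using assms incident_Int[OF edge] by blast
  then have "trim m raised f = raised f"
    by (intro trim_machine_undominated) (simp add: dominates_def)
  then show ?thesis using True by (simp add: respond_eq trim_job_at_machine)
qed (simp add: respond_eq)

lemma respond_at_machine: "f \<in> \<delta> m \<Longrightarrow> x' f = trim m raised f"
  by (simp add: respond_eq)

lemma respond_self: "x' (j, m) = x (j, m) + A"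
  using respond_at_job[OF at_job] trim_job_undominated by (simp add: dominates_def)

lemma respond_elsewhere: "f \<notin> \<delta> j \<Longrightarrow> f \<notin> \<delta> m \<Longrightarrow> x' f = x f"
  using at_job by (auto simp: respond_eq trim_def)

lemma respond_undominated:
  "f \<in> \<delta> j \<Longrightarrow> \<not> dominates j (j, m) f \<Longrightarrow> f \<noteq> (j, m) \<Longrightarrow> x' f = x f"
  "f \<in> \<delta> m \<Longrightarrow> \<not> dominates m (j, m) f \<Longrightarrow> f \<noteq> (j, m) \<Longrightarrow> x' f = x f"
  by (simp_all add: respond_at_job respond_at_machine trim_job_undominated trim_machine_undominated)

lemma raised_nonneg_edge: "f \<in> E \<Longrightarrow> 0 \<le> raised f"
  using bspec[OF raised_nonneg, of f "fst f"] by (simp add: incident_def)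

lemma respond_nonneg: "f \<in> E \<Longrightarrow> 0 \<le> x' f"
  unfolding respond_eq using trim_bounds(1)[of raised f, OF raised_nonneg_edge] by simp

lemma respond_le_raised: "f \<in> E \<Longrightarrow> x' f \<le> raised f"
  unfolding respond_eq using trim_bounds(2)[of raised f, OF raised_nonneg_edge]
  by (simp only: split: if_split) blast

lemma respond_le: "f \<in> E \<Longrightarrow> f \<noteq> (j, m) \<Longrightarrow> x' f \<le> x f"
  using respond_le_raised[of f] by simp

lemma load_respond_job: "load x' j = min (load x j + A) (q j)"
  using load_trim[of j raised] raised_nonneg job load_upd[OF at_job, of x A]
    load_cong[OF respond_at_job] by simp

lemma load_respond_machine: "load x' m = min (load x m + A) (q m)"
  using load_trim[of m raised] raised_nonneg machine load_upd[OF at_machine, of x A]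
    load_cong[OF respond_at_machine] by simp

lemma load_respond_other:
  assumes "v \<noteq> j" "v \<noteq> m"
  shows "load x' v \<le> load x v"
  unfolding load_def using assms respond_le
  by (intro sum_mono) (auto simp: incident_def)

lemma allocation_respond: "allocation x'"
  unfolding allocation_def
proof (intro conjI ballI)
  fix e assume e: "e \<in> E"
  show "0 \<le> x' e" using e by (rule respond_nonneg)
  show "x' e \<le> c e"
    using respond_self amount_le(4) respond_le[OF e] allocation_le_capacity[OF allocation e]
    by (cases "e = (j, m)") auto
next
  fix v assume "v \<in> J \<union> M"
  then show "load x' v \<le> q v"
    using load_respond_job load_respond_machine load_respond_other[of v]
      allocation_load_le[OF allocation, of v]
    by (cases "v = j"; cases "v = m") auto
qed

text \<open>Among the edges at least as good as \<open>(j, m)\<close>, only \<open>(j, m)\<close>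
  itself changes, so \<open>room_eq\<close> gives the difference.\<close>

lemma room_respond:
  assumes v: "v = j \<or> v = m"
  shows "room x' v (j, m) = room x v (j, m) - A"
proof -
  have e: "(j, m) \<in> \<delta> v" using v at_job at_machine by auto
  let ?S = "{f \<in> \<delta> v. rank v f \<le> rank v (j, m)}"
  have fin: "finite ?S" using finite_incident by auto
  have "sum x' (?S - {(j, m)}) = sum x (?S - {(j, m)})"
  proof (intro sum.cong refl)
    fix f assume "f \<in> ?S - {(j, m)}"
    then have "f \<in> \<delta> v" "\<not> dominates v (j, m) f" "f \<noteq> (j, m)" by (auto simp: dominates_def)
    then show "x' f = x f" using v respond_undominated by blast
  qed
  then have "sum x' ?S = sum x ?S + A"
    using e fin respond_self by (simp add: sum.remove[of ?S "(j, m)"])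
  then show ?thesis using room_eq[OF e] by simp
qed

lemma slack_respond: "slack x' (j, m) = slack x (j, m) - A"
  using room_respond[of m] respond_self by (simp add: slack_def)

text \<open>For \<open>f\<close> at or below \<open>(j, m)\<close>, the dominated load shrinks while
  the load of the machine does not. For better \<open>f\<close>, no edge counted in
  \<open>room_eq\<close> changes.\<close>

lemma room_machine_antimono:
  assumes f: "f \<in> \<delta> m"
  shows "room x' m f \<le> room x m f"
proof (cases "rank m (j, m) \<le> rank m f")
  case True
  have "dominated_load x' m f \<le> dominated_load x m f"
    unfolding dominated_load_def
  proof (rule sum_mono)
    fix g assume "g \<in> {g \<in> \<delta> m. dominates m f g}"
    then have "g \<in> E" "g \<noteq> (j, m)" using True incident_subset by (auto simp: dominates_def)
    then show "x' g \<le> x g" by (rule respond_le)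
  qed
  moreover have "load x m \<le> load x' m"
    using load_respond_machine amount_pos allocation_load_le[OF allocation, of m] machine by auto
  ultimately show ?thesis by (simp add: room_def)
next
  case False
  have "sum x' {g \<in> \<delta> m. rank m g \<le> rank m f} = sum x {g \<in> \<delta> m. rank m g \<le> rank m f}"
  proof (intro sum.cong refl)
    fix g assume "g \<in> {g \<in> \<delta> m. rank m g \<le> rank m f}"
    then have "g \<in> \<delta> m" "\<not> dominates m (j, m) g" "g \<noteq> (j, m)"
      using False by (auto simp: dominates_def)
    then show "x' g = x g" by (rule respond_undominated(2))
  qed
  then show ?thesis using room_eq[OF f] by simp
qed

lemma reduced_worst_first:
  assumes v: "v = j \<or> v = m" and f: "f \<in> \<delta> v" "x' f < x f" and g: "dominates v f g"
  shows "x' g = 0"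
proof -
  have "f \<noteq> (j, m)" using f(2) respond_self amount_pos by auto
  then have "raised f = x f" by simp
  then have "trim v raised f < raised f" using v f respond_at_job respond_at_machine by metis
  then have "trim v raised g = 0" using trim_worst_first raised_nonneg g by blast
  moreover have "g \<in> \<delta> v" using g by (simp add: dominates_def)
  ultimately show ?thesis using v respond_at_job respond_at_machine by metis
qed

text \<open>The machine reduces an edge only when its quota is exceeded, so afterwards the quota is
  full, and worst-first reduction has emptied everything below \<open>f\<close>.\<close>

lemma room_reduced:
  assumes f: "f \<in> \<delta> m" "x' f < x f"
  shows "room x' m f = 0"
proof -
  have "load x' m = q m"
  proof (rule ccontr)
    assume "load x' m \<noteq> q m"
    then have "load raised m \<le> q m"
      using load_respond_machine load_upd[OF at_machine, of x A] by auto
    then have "x' f = raised f"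
      using trim_eq_of_load_le[of m raised] raised_nonneg f respond_at_machine by simp
    then show False using f amount_pos by (auto split: if_splits)
  qed
  moreover have "dominated_load x' m f = 0"
    unfolding dominated_load_def using reduced_worst_first[of m f] f by (intro sum.neutral) auto
  ultimately show ?thesis by (simp add: room_def)
qed

text \<open>Without a loss on another edge the load of the job would grow by the full amount and
  exceed the quota.\<close>

lemma ex_reduced_at_job:
  assumes "q j - load x j < A"
  obtains g where "dominates j (j, m) g" "x' g < x g"
proof -
  have "\<exists>g\<in>\<delta> j - {(j, m)}. x' g < x g"
  proof (rule ccontr)
    assume "\<not> ?thesis"
    then have "sum x (\<delta> j - {(j, m)}) \<le> sum x' (\<delta> j - {(j, m)})"
      by (intro sum_mono) (auto simp: not_less)
    then have "load x j + A \<le> load x' j"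
      using at_job finite_incident respond_self by (simp add: load_def sum.remove[of "\<delta> j" "(j, m)"])
    then show False using load_respond_job assms by linarith
  qed
  then show ?thesis using that respond_undominated(1) by force
qed

section \<open>Responses within the free quota of the job\<close>

context
  assumes free: "A \<le> q j - load x j"
begin

lemma respond_at_job_free: "f \<in> \<delta> j \<Longrightarrow> f \<noteq> (j, m) \<Longrightarrow> x' f = x f"
  using trim_eq_of_load_le[of j raised] raised_nonneg free load_upd[OF at_job, of x A]
  by (simp add: respond_at_job)

lemma respond_off_machine: "f \<notin> \<delta> m \<Longrightarrow> x' f = x f"
  using respond_at_job_free respond_elsewhere at_machine by metis

lemma load_respond_job_free: "load x' j = load x j + A"
  using load_respond_job free by simp

lemma slack_off_machine:
  assumes f: "f \<in> E" "f \<notin> \<delta> m"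
  shows "slack x' f = slack x f"
proof -
  have sM: "snd f \<in> M" and "snd f \<noteq> m"
    using f edges by (auto simp: incident_def)
  then have "g \<notin> \<delta> m" if "g \<in> \<delta> (snd f)" for g
    using that incident_machine[OF sM] incident_machine[OF machine] by auto
  then have "room x' (snd f) f = room x (snd f) f"
    by (intro room_cong respond_off_machine)
  then show ?thesis using respond_off_machine[OF f(2)] by (simp add: slack_def)
qed

text \<open>An edge reduced by the machine gains residual capacity, but its room at the machine is
  then zero. For all other edges neither term of the slack grows.\<close>

lemma slack_antimono:
  assumes f: "f \<in> E"
  shows "slack x' f \<le> slack x f"
proof (cases "f \<in> \<delta> m")
  case True
  then have s: "snd f = m" using incident_machine[OF machine] by simp
  show ?thesis
  proof (cases "x' f < x f")
    case True
    then have "slack x' f \<le> 0" using room_reduced[OF \<open>f \<in> \<delta> m\<close>] s by (simp add: slack_def)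
    then show ?thesis using slack_nonneg[OF allocation f] by linarith
  next
    case False
    then show ?thesis using room_machine_antimono[OF \<open>f \<in> \<delta> m\<close>] s by (auto simp: slack_def)
  qed
qed (use slack_off_machine f in simp)

lemma slack_at_job_free: "f \<in> \<delta> j \<Longrightarrow> f \<noteq> (j, m) \<Longrightarrow> slack x' f = slack x f"
  using slack_off_machine incident_Int[OF edge] incident_subset by blast

text \<open>The job shares only \<open>(j, m)\<close> with the machine, so this is its only edge
  whose slack changes. The free quota drops by the same amount, so the inequality in
  \<open>settled\<close> for \<open>w\<close> keeps its truth value as long as \<open>w\<close>
  stays positive.\<close>

lemma sum_slack_respond:
  assumes w: "dominates j (j, m) w"
  shows "sum (slack x') {e. dominates j e w} = sum (slack x) {e. dominates j e w} - A"
proof -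
  let ?D = "{e. dominates j e w}"
  have fin: "finite ?D" by (rule finite_subset[OF _ finite_incident[of j]]) (auto simp: dominates_def)
  have "sum (slack x') (?D - {(j, m)}) = sum (slack x) (?D - {(j, m)})"
    by (intro sum.cong refl slack_at_job_free) (auto simp: dominates_def)
  then show ?thesis
    using w slack_respond sum.remove[OF fin, of "(j, m)" "slack x"]
      sum.remove[OF fin, of "(j, m)" "slack x'"] by simp
qed

text \<open>Another job gains on no edge: no new positive edge \<open>w\<close> arises, slacks do
  not grow, and the free quota does not shrink.\<close>

lemma settled_respond_other:
  assumes i: "i \<in> J" "i \<noteq> j" and settled: "settled x i"
  shows "settled x' i"
  unfolding settled_def
proof (intro ballI impI)
  fix w assume w: "w \<in> \<delta> i" "0 < x' w"
  have wE: "w \<in> E" and "w \<noteq> (j, m)" and im: "i \<noteq> m"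
    using w i incident_job[OF i(1)] machine disjoint by auto
  then have "0 < x w" using respond_le[OF wE] w(2) by simp
  have "sum (slack x') {e. dominates i e w} \<le> sum (slack x) {e. dominates i e w}"
    using incident_subset[of i] by (intro sum_mono slack_antimono) (auto simp: dominates_def)
  also have "\<dots> \<le> q i - load x i"
    using settled w(1) \<open>0 < x w\<close> by (simp add: settled_def)
  also have "\<dots> \<le> q i - load x' i" using load_respond_other[OF i(2) im] by simp
  finally show "sum (slack x') {e. dominates i e w} \<le> q i - load x' i" .
qed

lemma settled_respond_self:
  assumes best: "best_blocking x j m" and settled: "settled x j"
  shows "settled x' j"
  unfolding settled_def
proof (intro ballI impI)
  fix w assume w: "w \<in> \<delta> j" "0 < x' w"
  show "sum (slack x') {e. dominates j e w} \<le> q j - load x' j"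
  proof (cases "dominates j (j, m) w")
    case True
    then have "w \<noteq> (j, m)" by (auto simp: dominates_def)
    then have "0 < x w" using respond_at_job_free[OF w(1)] w(2) by simp
    then show ?thesis
      using settled w(1) sum_slack_respond[OF True] load_respond_job_free by (simp add: settled_def)
  next
    case False
    \<comment> \<open>Here every edge above \<open>w\<close> is better than \<open>(j, m)\<close>.
      With slack left it would block \<open>x\<close>, because the job has free quota, contradicting
      the choice of \<open>(j, m)\<close> as best.\<close>
    have "slack x' e \<le> 0" if e: "dominates j e w" for e
    proof (rule ccontr)
      assume "\<not> slack x' e \<le> 0"
      have ej: "e \<in> \<delta> j" and lt: "rank j e < rank j (j, m)"
        using e False at_job w(1) by (auto simp: dominates_def)
      then obtain k where k: "e = (j, k)" "(j, k) \<in> E"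
        using incident_job[OF job] by (metis prod.collapse)
      have "0 < slack x e" using \<open>\<not> slack x' e \<le> 0\<close> slack_antimono[of e] k by simp
      moreover have "0 < room x j e"
        using free amount_pos dominated_load_nonneg[OF incident_nonneg, of j e]
        unfolding room_def by linarith
      ultimately have "blocks x j k"
        using k blocks_iff[OF allocation] by (simp add: response_amount_eq)
      then show False using best lt k(1) by (auto simp: best_blocking_def dominates_def)
    qed
    then have "sum (slack x') {e. dominates j e w} \<le> 0" by (intro sum_nonpos) auto
    then show ?thesis using allocation_load_le[OF allocation_respond, of j] job by simp
  qed
qed

text \<open>The load of the machine does not fall, so its other edges lose at most \<open>A\<close>
  in total, and only dominated edges lose. Weights are natural numbers, so a unit lost costs at most
  \<open>W (j, m) - 1\<close>, while a unit raised earns \<open>W (j, m)\<close>. The net gain is at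
  least \<open>A\<close>.\<close>

lemma weighted_respond_machine:
  fixes W :: "'v \<times> 'v \<Rightarrow> nat"
  assumes W: "\<And>e f. dominates m e f \<Longrightarrow> W f < W e" and pos: "0 < W (j, m)"
  shows "(\<Sum>e\<in>E. x e * W e) < (\<Sum>e\<in>E. x' e * W e)"
proof -
  let ?e = "(j, m)" and ?d = "\<lambda>f. x' f - x f"
  have "(real (W ?e) - 1) * ?d f \<le> ?d f * W f" if "f \<in> \<delta> m - {?e}" for f
  proof (cases "dominates m ?e f")
    case True
    then have "real (W f) \<le> real (W ?e) - 1" using W[OF True] by simp
    moreover have "?d f \<le> 0" using that respond_le[of f] incident_subset by auto
    ultimately show ?thesis using mult_left_mono_neg[of "real (W f)" "W ?e - 1" "?d f"]
      by (simp add: mult.commute)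
  next
    case False
    then have "?d f = 0" using that respond_undominated(2)[of f] by auto
    then show ?thesis by simp
  qed
  then have "(\<Sum>f\<in>\<delta> m - {?e}. (real (W ?e) - 1) * ?d f) \<le> (\<Sum>f\<in>\<delta> m - {?e}. ?d f * W f)"
    by (rule sum_mono)
  moreover have "(\<Sum>f\<in>\<delta> m - {?e}. ?d f) = load x' m - load x m - A"
    using at_machine finite_incident respond_self
    by (simp add: load_def sum.remove[of "\<delta> m" ?e] sum_subtractf)
  moreover have "load x m \<le> load x' m"
    using load_respond_machine amount_pos allocation_load_le[OF allocation, of m] machine by auto
  then have "(real (W ?e) - 1) * (- A) \<le> (real (W ?e) - 1) * (load x' m - load x m - A)"
    using pos by (intro mult_left_mono) auto
  ultimately have "(real (W ?e) - 1) * (- A) \<le> (\<Sum>f\<in>\<delta> m - {?e}. ?d f * W f)"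
    by (simp add: sum_distrib_left[symmetric])
  moreover have "(\<Sum>f\<in>E. ?d f * W f) = (\<Sum>f\<in>\<delta> m. ?d f * W f)"
    using finite_edges incident_subset respond_off_machine by (intro sum.mono_neutral_right) auto
  then have "(\<Sum>f\<in>E. ?d f * W f) = A * W ?e + (\<Sum>f\<in>\<delta> m - {?e}. ?d f * W f)"
    using at_machine finite_incident respond_self by (simp add: sum.remove[of "\<delta> m" ?e])
  ultimately have "A \<le> (\<Sum>f\<in>E. ?d f * W f)" by (simp add: algebra_simps)
  then show ?thesis using amount_pos by (simp add: left_diff_distrib sum_subtractf)
qed

end

text \<open>If \<open>(j, m)\<close> dominates a positive edge \<open>w\<close>, its slack is a
  summand in the condition of \<open>settled\<close> for \<open>w\<close>. Otherwise the room at the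
  job is just its free quota.\<close>

lemma settled_amount_le_free:
  assumes "settled x j"
  shows "A \<le> q j - load x j"
proof (cases "0 < dominated_load x j (j, m)")
  case True
  then obtain w where w: "dominates j (j, m) w" "0 < x w"
    using dominated_load_pos_iff[OF incident_nonneg] by auto
  let ?D = "{e. dominates j e w}"
  have sub: "?D \<subseteq> \<delta> j" by (auto simp: dominates_def)
  have "slack x (j, m) \<le> sum (slack x) ?D"
  proof (rule member_le_sum)
    fix e assume "e \<in> ?D - {(j, m)}"
    then show "0 \<le> slack x e" using sub incident_subset slack_nonneg[OF allocation] by blast
  qed (use w(1) finite_subset[OF sub finite_incident] in auto)
  then show ?thesis
    using assms w amount_le(2) unfolding settled_def by (force simp: dominates_def)
next
  case False
  then show ?thesis using amount_le(1) by (simp add: room_def)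
qed

end

context stable_allocation_instance
begin

lemma response_if_best_blocking:
  "allocation x \<Longrightarrow> best_blocking x j m \<Longrightarrow> response J M E q c rank x j m"
  using blocks_iff by unfold_locales (auto simp: best_blocking_def)

end

section \<open>Data with common denominator N\<close>

locale integral_instance = stable_allocation_instance J M E q c rank
  for J M :: "'v set" and E q c rank +
  fixes N :: nat
  assumes N_pos: "0 < N"
    and integral_quota: "v \<in> J \<union> M \<Longrightarrow> real N * q v \<in> \<int>"
    and integral_capacity: "e \<in> E \<Longrightarrow> real N * c e \<in> \<int>"
begin

abbreviation "lattice t \<equiv> real N * t \<in> \<int>"

definition integral :: "('v \<times> 'v \<Rightarrow> real) \<Rightarrow> bool" where
  "integral x \<longleftrightarrow> (\<forall>e\<in>E. lattice (x e))"

lemma lattice_add: "lattice s \<Longrightarrow> lattice t \<Longrightarrow> lattice (s + t)"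
  and lattice_diff: "lattice s \<Longrightarrow> lattice t \<Longrightarrow> lattice (s - t)"
  and lattice_min: "lattice s \<Longrightarrow> lattice t \<Longrightarrow> lattice (min s t)"
  and lattice_max: "lattice s \<Longrightarrow> lattice t \<Longrightarrow> lattice (max s t)"
  and lattice_mult: "lattice s \<Longrightarrow> lattice (s * of_nat k)"
  by (auto simp: distrib_left right_diff_distrib min_def max_def mult.assoc[symmetric])

lemma lattice_sum: "(\<And>e. e \<in> S \<Longrightarrow> lattice (f e)) \<Longrightarrow> lattice (sum f S)"
  by (auto simp: sum_distrib_left)

lemmas lattice_intros = lattice_add lattice_diff lattice_min lattice_max lattice_mult lattice_sum

lemma lattice_gap:
  assumes "lattice s" "lattice t" "s < t"
  shows "1 \<le> real N * (t - s)"
proof -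
  obtain a b :: int where ab: "real N * s = a" "real N * t = b"
    using assms by (auto elim!: Ints_cases)
  then have "real_of_int a < real_of_int b"
    using assms(3) N_pos by (metis mult_strict_left_mono of_nat_0_less_iff)
  then show ?thesis using ab by (simp add: right_diff_distrib)
qed

text \<open>Lattice values differ by at least 1/N, so scaling by \<open>N\<close> turns a strict
  inequality into a drop of at least one. Nonnegativity of the smaller value keeps
  \<open>nat\<close> from collapsing the two.\<close>

lemma lattice_measure:
  assumes "lattice s" "lattice t" "s < t" "0 \<le> s"
  shows "nat \<lfloor>real N * s\<rfloor> < nat \<lfloor>real N * t\<rfloor>"
proof -
  have "real N * s + 1 \<le> real N * t"
    using lattice_gap[OF assms(1-3)] by (simp add: right_diff_distrib)
  then have "\<lfloor>real N * s\<rfloor> + 1 \<le> \<lfloor>real N * t\<rfloor>" by linarith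
  moreover have "0 \<le> \<lfloor>real N * s\<rfloor>" using assms(4) by simp
  ultimately show ?thesis by linarith
qed

lemma integral_trim:
  assumes "v \<in> J \<union> M" "integral y"
  shows "integral (trim v y)"
  using assms integral_quota incident_subset
  unfolding integral_def trim_def load_def dominated_load_def
  by (auto intro!: lattice_intros)

text \<open>The response amount and both trims are built from sums, differences, minima and maxima,
  under which the lattice is closed.\<close>

lemma integral_respond:
  assumes "integral x" "(j, m) \<in> E"
  shows "integral (respond x j m)"
proof -
  have room: "lattice (room x v e)" if "v \<in> J \<union> M" for v e
  proof -
    have "lattice (x f)" if "f \<in> \<delta> v" for f
      using that assms(1) incident_subset by (auto simp: integral_def)
    then show ?thesis
      using integral_quota[OF that] unfolding room_def load_def dominated_load_def
      by (intro lattice_intros) auto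
  qed
  have "lattice (response_amount x j m)"
    using assms integral_capacity edge_endpoints[OF assms(2)]
    unfolding response_amount_eq slack_def
    by (intro lattice_intros room) (auto simp: integral_def)
  then have "integral (x((j, m) := x (j, m) + response_amount x j m))"
    using assms by (auto simp: integral_def intro!: lattice_intros)
  then show ?thesis
    unfolding respond_def using integral_trim edge_endpoints[OF assms(2)] by blast
qed

section \<open>The two potentials\<close>

definition machine_weight :: "'v \<times> 'v \<Rightarrow> nat" where
  "machine_weight e = Suc (\<Sum>f\<in>E. rank (snd f) f) - rank (snd e) e"

text \<open>Weighting the residual capacity instead of \<open>x\<close> turns the growing total into
  a nonnegative decreasing one.\<close>

definition machine_measure :: "('v \<times> 'v \<Rightarrow> real) \<Rightarrow> nat" where
  "machine_measure x = nat \<lfloor>real N * (\<Sum>e\<in>E. (c e - x e) * machine_weight e)\<rfloor>"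

lemma machine_measure_respond:
  assumes "response J M E q c rank x j m" and x: "integral x"
    and free: "response_amount x j m \<le> q j - load x j"
  shows "machine_measure (respond x j m) < machine_measure x"
proof -
  interpret response J M E q c rank x j m by fact
  \<comment> \<open>No rank exceeds the sum of all ranks, so the natural-number subtraction in
    \<open>machine_weight\<close> does not truncate on \<open>E\<close>, and the weights are
    positive there.\<close>
  have le: "rank (snd e) e \<le> (\<Sum>f\<in>E. rank (snd f) f)" if "e \<in> E" for e
    using that finite_edges by (intro member_le_sum[of e E "\<lambda>f. rank (snd f) f"]) auto
  have "machine_weight f < machine_weight e" if "dominates m e f" for e f
    using that le[of e] le[of f] incident_machine[OF machine]
    by (auto simp: machine_weight_def dominates_def)
  then have lt: "(\<Sum>e\<in>E. x e * machine_weight e) < (\<Sum>e\<in>E. x' e * machine_weight e)"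
    using le[OF edge] by (intro weighted_respond_machine[OF free]) (auto simp: machine_weight_def)
  show ?thesis
    unfolding machine_measure_def
  proof (rule lattice_measure)
    show "(\<Sum>e\<in>E. (c e - x' e) * machine_weight e) < (\<Sum>e\<in>E. (c e - x e) * machine_weight e)"
      using lt by (simp add: left_diff_distrib sum_subtractf)
    show "0 \<le> (\<Sum>e\<in>E. (c e - x' e) * machine_weight e)"
      using allocation_le_capacity[OF allocation_respond] by (intro sum_nonneg) auto
  qed (use x integral_respond[OF x edge] integral_capacity in
    \<open>auto simp: integral_def intro!: lattice_intros\<close>)
qed

text \<open>The successor makes the bound strict and keeps the base at least 1 even if all
  capacities vanish.\<close>

definition job_base :: nat where
  "job_base = Suc (nat \<lceil>real N * sum c E\<rceil>)"

definition job_measure :: "('v \<times> 'v \<Rightarrow> real) \<Rightarrow> nat" where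
  "job_measure x = nat \<lfloor>real N * (\<Sum>e\<in>E. x e * (job_base ^ rank (fst e) e :: nat))\<rfloor>"

lemma job_measure_less:
  assumes x: "allocation x" "integral x" and y: "allocation y" "integral y"
    and j: "j \<in> J" and h: "h \<in> \<delta> j" "y h < x h"
    and worse: "\<And>f. f \<in> \<delta> j \<Longrightarrow> rank j h < rank j f \<Longrightarrow> y f \<le> x f"
    and off: "\<And>f. f \<in> E \<Longrightarrow> f \<notin> \<delta> j \<Longrightarrow> y f \<le> x f"
  shows "job_measure y < job_measure x"
proof -
  text \<open>The base exceeds \<open>N\<close> times the total capacity, so the loss of at least \<open>1/N\<close> on \<open>h\<close>
    outweighs any gain on the edges \<open>?L\<close> that the job ranks above \<open>h\<close>.\<close>
  let ?r = "rank j h" and ?B = "real job_base"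
  let ?w = "\<lambda>e. job_base ^ rank (fst e) e"
  let ?d = "\<lambda>e. (x e - y e) * real (?w e)"
  let ?L = "{f \<in> \<delta> j. rank j f < ?r}"
  have B: "1 \<le> ?B" "real N * sum c E < ?B"
    unfolding job_base_def by (simp, linarith)
  have hE: "h \<in> E" and LE: "?L \<subseteq> E" and hw: "?w h = job_base ^ ?r"
    using h(1) incident_subset incident_job[OF j] by auto
  \<comment> \<open>An edge better than \<open>h\<close> has exponent at most \<open>?r - 1\<close>.
    The extra factor \<open>?B\<close> on the right expresses this without a subtraction that would
    truncate at \<open>?r = 0\<close>.\<close>
  have "- (c f * ?B ^ ?r) \<le> ?B * ?d f" if f: "f \<in> ?L" for f
  proof -
    have fE: "f \<in> E" and ff: "fst f = j" using f incident_job[OF j] by auto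
    have "?B * ?B ^ rank j f \<le> ?B ^ ?r"
      using f B(1) by (subst power_Suc[symmetric]) (intro power_increasing, auto)
    then have "y f * (?B * ?B ^ rank j f) \<le> c f * ?B ^ ?r"
      using allocation_nonneg[OF y(1) fE] allocation_le_capacity[OF y(1) fE] B(1)
      by (intro mult_mono) auto
    moreover have "0 \<le> x f * (?B * ?B ^ rank j f)"
      using allocation_nonneg[OF x(1) fE] by simp
    ultimately show ?thesis by (simp add: ff algebra_simps)
  qed
  then have "(\<Sum>f\<in>?L. - (c f * ?B ^ ?r)) \<le> (\<Sum>f\<in>?L. ?B * ?d f)" by (rule sum_mono)
  moreover have "sum c ?L \<le> sum c E"
    using LE finite_edges capacity_nonneg by (intro sum_mono2) auto
  then have "sum c ?L * ?B ^ ?r \<le> sum c E * ?B ^ ?r" by (intro mult_right_mono) auto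
  ultimately have L: "- (sum c E * ?B ^ ?r) \<le> ?B * sum ?d ?L"
    by (simp add: sum_distrib_left sum_distrib_right sum_negf)
  have "0 \<le> ?d f" if f: "f \<in> E - insert h ?L" for f
  proof -
    have "y f \<le> x f"
    proof (cases "f \<in> \<delta> j")
      case True
      then have "rank j f \<noteq> ?r"
        using f h(1) strict_rank[of j] j by (auto simp: inj_on_def)
      then show ?thesis using f True worse[of f] by auto
    qed (use f off in auto)
    then show ?thesis by simp
  qed
  then have H: "0 \<le> sum ?d (E - insert h ?L)" by (rule sum_nonneg)
  have "sum ?d E = sum ?d (insert h ?L) + sum ?d (E - insert h ?L)"
    using hE LE finite_edges by (simp add: sum.subset_diff[of "insert h ?L" E] add.commute)
  also have "sum ?d (insert h ?L) = ?d h + sum ?d ?L"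
    using finite_subset[OF LE finite_edges] by simp
  finally have sum: "sum ?d E = ?d h + sum ?d ?L + sum ?d (E - insert h ?L)" .
  have "1 \<le> real N * (x h - y h)"
    using x(2) y(2) hE h(2) by (intro lattice_gap) (auto simp: integral_def)
  then have "?B * ?B ^ ?r * 1 \<le> ?B * ?B ^ ?r * (real N * (x h - y h))"
    by (intro mult_left_mono) auto
  then have "?B * ?B ^ ?r \<le> real N * (?B * ?d h)" by (simp add: hw mult_ac)
  moreover have "real N * sum c E * ?B ^ ?r < ?B * ?B ^ ?r"
    using B by (intro mult_strict_right_mono) auto
  moreover have "real N * (- (sum c E * ?B ^ ?r)) \<le> real N * (?B * sum ?d ?L)"
    using L by (intro mult_left_mono) auto
  moreover have "0 \<le> real N * (?B * sum ?d (E - insert h ?L))" using H by simp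
  ultimately have "0 < real N * ?B * sum ?d E" unfolding sum by (simp add: algebra_simps)
  then have "0 < sum ?d E" by (rule zero_less_mult_pos) (use N_pos B(1) in simp)
  then have lt: "(\<Sum>e\<in>E. y e * real (?w e)) < (\<Sum>e\<in>E. x e * real (?w e))"
    by (simp add: left_diff_distrib sum_subtractf)
  show ?thesis
    unfolding job_measure_def
  proof (rule lattice_measure[OF _ _ lt])
    show "0 \<le> (\<Sum>e\<in>E. y e * real (?w e))"
      using allocation_nonneg[OF y(1)] by (intro sum_nonneg) auto
  qed (use x(2) y(2) in \<open>auto simp only: integral_def intro!: lattice_sum lattice_mult\<close>)
qed

section \<open>First phase: reaching a settled allocation\<close>

lemma ex_reallocation:
  assumes "allocation x" "integral x" and j: "j \<in> J" and w: "w \<in> \<delta> j" "0 < x w"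
    and "q j - load x j < sum (slack x) {e. dominates j e w}"
  obtains y h where "best_response_step\<^sup>*\<^sup>* x y" "allocation y" "integral y"
    "h \<in> \<delta> j" "rank j w \<le> rank j h" "y h < x h"
    "\<forall>f\<in>\<delta> j. rank j h < rank j f \<longrightarrow> y f \<le> x f" "\<forall>f\<in>E - \<delta> j. y f \<le> x f"
proof -
  have "\<exists>y h. best_response_step\<^sup>*\<^sup>* x y \<and> allocation y \<and> integral y \<and>
      h \<in> \<delta> j \<and> rank j w \<le> rank j h \<and> y h < x h \<and>
      (\<forall>f\<in>\<delta> j. rank j h < rank j f \<longrightarrow> y f \<le> x f) \<and> (\<forall>f\<in>E - \<delta> j. y f \<le> x f)"
    using assms(1,2,5,6)
  \<comment> \<open>Responses within the free quota keep the hypothesis on \<open>w\<close> and do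
    not touch edges of \<open>j\<close> at or below \<open>w\<close>. They lower
    \<open>machine_measure\<close>, so at some point a response must exceed the free quota, and this
    one reallocates.\<close>
  proof (induction x rule: measure_induct_rule[of machine_measure])
    case (less x)
    let ?D = "{e. dominates j e w}"
    have "0 < sum (slack x) ?D"
      using less.prems(4) allocation_load_le[OF less.prems(1), of j] j by simp
    \<comment> \<open>Some edge above \<open>w\<close> has slack, and the job has room for it
      because it could give up \<open>w\<close>. So this edge blocks, and the best blocking edge
      dominates \<open>w\<close> as well.\<close>
    then obtain e where e: "dominates j e w" "0 < slack x e"
      by (metis mem_Collect_eq not_less sum_nonpos)
    then obtain k where k: "e = (j, k)" "(j, k) \<in> E"
      using incident_job[OF j] by (metis dominates_def prod.collapse)
    have nn: "\<forall>f\<in>\<delta> j. 0 \<le> x f"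
      using allocation_nonneg[OF less.prems(1)] incident_subset by blast
    have room: "q j - load x j < room x j f" if "dominates j f w" for f
    proof -
      have "0 < dominated_load x j f"
        unfolding dominated_load_pos_iff[OF nn] using that less.prems(3) by blast
      then show ?thesis by (simp add: room_def)
    qed
    have "0 < room x j e" using room[OF e(1)] allocation_load_le[OF less.prems(1), of j] j by simp
    then have "blocks x j k"
      using e(2) k blocks_iff[OF less.prems(1)] by (simp add: response_amount_eq)
    then obtain m where m: "best_blocking x j m" "rank j (j, m) \<le> rank j (j, k)"
      by (rule ex_best_blocking)
    interpret response J M E q c rank x j m
      by (rule response_if_best_blocking[OF less.prems(1) m(1)])
    have dom: "dominates j (j, m) w"
      using m(2) e(1) k(1) at_job by (auto simp: dominates_def)
    have step: "best_response_step x x'" and alloc': "allocation x'" and int': "integral x'"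
      using m(1) job machine allocation_respond integral_respond[OF less.prems(2) edge]
      by (auto simp: best_response_step_def)
    show ?case
    proof (cases "A \<le> q j - load x j")
      case True
      have same: "x' f = x f" if "f \<in> \<delta> j" "rank j w \<le> rank j f" for f
      proof (rule respond_at_job_free[OF True that(1)])
        show "f \<noteq> (j, m)" using that(2) dom by (auto simp: dominates_def)
      qed
      have "\<exists>y h. best_response_step\<^sup>*\<^sup>* x' y \<and> allocation y \<and> integral y \<and>
          h \<in> \<delta> j \<and> rank j w \<le> rank j h \<and> y h < x' h \<and>
          (\<forall>f\<in>\<delta> j. rank j h < rank j f \<longrightarrow> y f \<le> x' f) \<and> (\<forall>f\<in>E - \<delta> j. y f \<le> x' f)"
      proof (rule less.IH)
        show "machine_measure x' < machine_measure x"
          by (rule machine_measure_respond[OF response_axioms less.prems(2) True])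
        show "0 < x' w" using same[OF w(1)] less.prems(3) by simp
        show "q j - load x' j < sum (slack x') ?D"
          using sum_slack_respond[OF True dom] load_respond_job_free[OF True] less.prems(4) by simp
      qed (use alloc' int' in auto)
      then obtain y h where y: "best_response_step\<^sup>*\<^sup>* x' y" "allocation y" "integral y"
        and h: "h \<in> \<delta> j" "rank j w \<le> rank j h" "y h < x' h"
        and le: "\<forall>f\<in>\<delta> j. rank j h < rank j f \<longrightarrow> y f \<le> x' f" "\<forall>f\<in>E - \<delta> j. y f \<le> x' f"
        by blast
      \<comment> \<open>Off \<open>j\<close>, an edge can only lose in the first response as well,
        since the raised edge belongs to \<open>j\<close>.\<close>
      have "y f \<le> x f" if f: "f \<in> E - \<delta> j" for f
      proof -
        have "f \<noteq> (j, m)" using f at_job by blast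
        then show ?thesis using le(2) f respond_le[of f] by force
      qed
      moreover have "y f \<le> x f" if "f \<in> \<delta> j" "rank j h < rank j f" for f
        using le(1) that same[of f] h(2) by auto
      ultimately show ?thesis
        using converse_rtranclp_into_rtranclp[of best_response_step, OF step y(1)]
          y(2,3) h same[OF h(1,2)]
        by (intro exI[of _ y] exI[of _ h]) auto
    next
      case False
      then obtain g where g: "dominates j (j, m) g" "x' g < x g" using ex_reduced_at_job by auto
      then have gj: "g \<in> \<delta> j" by (auto simp: dominates_def)
      \<comment> \<open>If the reduced edge \<open>g\<close> is better than \<open>w\<close>,
        worst-first reduction has already emptied \<open>w\<close>, and \<open>w\<close> itself
        serves as \<open>h\<close>.\<close>
      have "\<exists>h\<in>\<delta> j. rank j w \<le> rank j h \<and> x' h < x h"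
      proof (cases "rank j w \<le> rank j g")
        case False
        then have "x' w = 0"
          using reduced_worst_first[of j g w] g(2) gj w(1) by (auto simp: dominates_def)
        then show ?thesis using w(1) less.prems(3) by auto
      qed (use g gj in auto)
      then obtain h where h: "h \<in> \<delta> j" "rank j w \<le> rank j h" "x' h < x h" by auto
      have "x' f \<le> x f" if "f \<in> \<delta> j" "rank j h < rank j f" for f
      proof (rule respond_le)
        show "f \<in> E" using that incident_subset by blast
        show "f \<noteq> (j, m)" using that(2) h(2) dom by (auto simp: dominates_def)
      qed
      moreover have "x' f \<le> x f" if "f \<in> E - \<delta> j" for f
        using that respond_le[of f] at_job by auto
      ultimately show ?thesis
        using r_into_rtranclp[of best_response_step, OF step] alloc' int' h by blast
    qed
  qed
  then show ?thesis using that by blast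
qed

text \<open>\<open>job_measure\<close> is compared only before and after a whole sequence from
  \<open>ex_reallocation\<close>; single responses within the free quota may raise it.\<close>

lemma ex_settled:
  assumes "allocation x" "integral x"
  shows "\<exists>y. best_response_step\<^sup>*\<^sup>* x y \<and> allocation y \<and> integral y \<and> (\<forall>j\<in>J. settled y j)"
  using assms
proof (induction x rule: measure_induct_rule[of job_measure])
  case (less x)
  show ?case
  proof (cases "\<forall>j\<in>J. settled x j")
    case False
    then obtain j w where jw: "j \<in> J" "w \<in> \<delta> j" "0 < x w"
      "q j - load x j < sum (slack x) {e. dominates j e w}"
      unfolding settled_def by (meson not_less)
    obtain y h where y: "best_response_step\<^sup>*\<^sup>* x y" "allocation y" "integral y"
      and h: "h \<in> \<delta> j" "rank j w \<le> rank j h" "y h < x h"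
      and le: "\<forall>f\<in>\<delta> j. rank j h < rank j f \<longrightarrow> y f \<le> x f" "\<forall>f\<in>E - \<delta> j. y f \<le> x f"
      by (rule ex_reallocation[OF less.prems jw])
    have "job_measure y < job_measure x"
      using le by (intro job_measure_less[OF less.prems y(2,3) jw(1) h(1,3)]) auto
    from less.IH[OF this y(2,3)] show ?thesis using y(1) by (meson rtranclp_trans)
  qed (use less.prems in blast)
qed

section \<open>Second phase: from settled to stable\<close>

lemma ex_stable_of_settled:
  assumes "allocation x" "integral x" "\<forall>j\<in>J. settled x j"
  shows "\<exists>y. best_response_step\<^sup>*\<^sup>* x y \<and> stable y"
  using assms
proof (induction x rule: measure_induct_rule[of machine_measure])
  case (less x)
  show ?case
  proof (cases "stable x")
    case False
    then obtain j k where "blocks x j k" using less.prems(1) by (auto simp: stable_def)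
    then obtain m where m: "best_blocking x j m" by (rule ex_best_blocking)
    interpret response J M E q c rank x j m
      by (rule response_if_best_blocking[OF less.prems(1) m])
    \<comment> \<open>Since all jobs are settled, every response stays within the free quota, so
      here \<open>machine_measure\<close> drops at each single step.\<close>
    have free: "A \<le> q j - load x j"
      using settled_amount_le_free less.prems(3) job by blast
    have "\<forall>i\<in>J. settled x' i"
      using settled_respond_other[OF free] settled_respond_self[OF free m] less.prems(3) by metis
    then obtain y where y: "best_response_step\<^sup>*\<^sup>* x' y" "stable y"
      using less.IH[OF machine_measure_respond[OF response_axioms less.prems(2) free]]
        allocation_respond integral_respond[OF less.prems(2) edge] by blast
    have "best_response_step x x'" using m job machine by (auto simp: best_response_step_def)
    then show ?thesis using y by (meson converse_rtranclp_into_rtranclp)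
  qed blast
qed

end

section \<open>Rational data and the final theorem\<close>

lemma common_denominator:
  fixes S :: "real set"
  assumes "finite S" "S \<subseteq> \<rat>"
  obtains N :: nat where "0 < N" "\<forall>t\<in>S. real N * t \<in> \<int>"
proof -
  have "\<exists>N::nat. 0 < N \<and> (\<forall>t\<in>S. real N * t \<in> \<int>)"
    using assms
  proof (induction S rule: finite_induct)
    case (insert s S)
    then obtain K :: nat where K: "0 < K" "\<forall>t\<in>S. real K * t \<in> \<int>" by auto
    have "s \<in> \<rat>" using insert.prems by simp
    then obtain a b :: int where ab: "0 < b" "s = of_int a / of_int b"
      by (rule Rats_cases')
    let ?N = "K * nat b"
    have "real ?N * s = of_int (int K * a)" using ab by simp
    then have "real ?N * s \<in> \<int>" by (metis Ints_of_int)
    moreover have "real ?N * t \<in> \<int>" if "t \<in> S" for t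
    proof -
      have "real ?N * t = of_int b * (real K * t)" using ab(1) by simp
      then show ?thesis using K(2) that by (metis Ints_mult Ints_of_int)
    qed
    ultimately show ?case using K(1) ab(1) by (intro exI[of _ ?N]) auto
  qed (auto intro: exI[of _ 1])
  then show ?thesis using that by blast
qed

theorem theorem4:
  fixes J M :: "'v set"
    and E :: "('v \<times> 'v) set"
    and q :: "'v \<Rightarrow> real"
    and c x :: "'v \<times> 'v \<Rightarrow> real"
    and rank :: "'v \<Rightarrow> 'v \<times> 'v \<Rightarrow> nat"
  assumes "stable_allocation_instance J M E q c rank"
    and "\<forall>v\<in>J \<union> M. q v \<in> \<rat>"
    and "\<forall>e\<in>E. c e \<in> \<rat>"
    and "stable_allocation_instance.allocation J M E q c x"
    and "\<forall>e\<in>E. x e \<in> \<rat>"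
  shows "\<exists>y. (stable_allocation_instance.best_response_step J M E q c rank)\<^sup>*\<^sup>* x y
           \<and> stable_allocation_instance.stable J M E q c rank y"
proof -
  interpret stable_allocation_instance J M E q c rank by fact
  \<comment> \<open>The values of \<open>x\<close> are included so that the starting allocation lies
    on the lattice too.\<close>
  let ?S = "q ` (J \<union> M) \<union> c ` E \<union> x ` E"
  have "finite ?S" using finite_jobs finite_machines finite_edges by simp
  moreover have "?S \<subseteq> \<rat>" using assms(2,3,5) by auto
  ultimately obtain N :: nat where N: "0 < N" "\<forall>t\<in>?S. real N * t \<in> \<int>"
    by (rule common_denominator)
  interpret integral_instance J M E q c rank N
    using N by unfold_locales auto
  have "integral x" using N(2) by (auto simp: integral_def)
  then show ?thesis
    using ex_settled[OF assms(4)] ex_stable_of_settled by (meson rtranclp_trans)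
qed

end
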